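(* Let $n\ge 1$ be an integer, let $a_0,\dots,a_{n-1}\in\{-1,+1\}$, and extend to an infinite sequence by $a_{n+k}=a_k$ for all $k\ge 0$. Put $P_m=\prod_{k=0}^{m}a_k$ for $0\le m\le n-1$ and $P=P_{n-1}$. Then the continued radical $$a_0\sqrt{2+a_1\sqrt{2+a_2\sqrt{2+a_3\sqrt{2+\cdots}}}}$$ converges, and its value is $$x = 2\cos\left(\frac{2\pi \ell}{2^n-P}\right),$$ where $\ell$ is the integer determined by $$2\ell = 2^{n-1}-P-\sum_{m=0}^{n-2}2^{\,n-2-m}P_m .$$ Moreover, as $(a_0,\dots,a_{n-1})$ runs over all sequences in $\{-1,+1\}^n$ with $P=+1$, the integer $\ell$ takes each of the values $0,1,\dots,2^{n-1}-1$ exactly once, so that the values of the continued radicals are $2\cos\left(\frac{2\pi\ell}{2^n-1}\right)$, $\ell=0,1,\dots,2^{n-1}-1$; and as $(a_0,\dots,a_{n-1})$ runs over all sequences in $\{-1,+1\}^n$ with $P=-1$, the integer $\ell$ takes each of the values $1,2,\dots,2^{n-1}$ exactly once, so that the values of the continued radicals are $2\cos\left(\frac{2\pi\ell}{2^n+1}\right)$, $\ell=1,\dots,2^{n-1}$.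
   Context: For a sequence $(a_k)_{k\ge0}$ with $a_k\in\{-1,+1\}$, the continued radical $a_0\sqrt{2+a_1\sqrt{2+a_2\sqrt{2+\cdots}}}$ means the limit as $m\to\infty$ (when it exists) of the finite nested radicals $$x_m = a_0\sqrt{2+a_1\sqrt{2+a_2\sqrt{2+\cdots+a_{m-1}\sqrt{2}}}},\qquad m\ge 1,$$ with $x_1=a_0\sqrt2$; it converges if this limit exists, and the limit is its value. The integer $n$ is a period of the sign sequence but need not be the minimal one. For $n=1$ the sum $\sum_{m=0}^{n-2}$ is empty, equal to $0$. *)

theory Defs
  imports Complex_Main "HOL-Library.FuncSet"
begin

text \<open>
  \<open>nested_radical a m\<close> is the finite radical \<open>x\<^sub>m\<close> of depth \<open>m\<close>; its
  innermost factor is \<open>a (m - 1) * sqrt 2\<close>. The value at depth 0 only serves to start the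
  recursion. If every \<open>a k\<close> is 1 or -1, all radicands lie between 0 and 4, so the convention
  of \<^const>\<open>sqrt\<close> on negative numbers is irrelevant.
\<close>

fun nested_radical :: "(nat \<Rightarrow> int) \<Rightarrow> nat \<Rightarrow> real" where
  "nested_radical a 0 = 0"
| "nested_radical a (Suc m) = real_of_int (a 0) * sqrt (2 + nested_radical (\<lambda>k. a (Suc k)) m)"

definition continued_radical_converges :: "(nat \<Rightarrow> int) \<Rightarrow> bool" where
  "continued_radical_converges a \<longleftrightarrow> convergent (nested_radical a)"

text \<open>Meaningful only if the continued radical converges.\<close>

definition continued_radical :: "(nat \<Rightarrow> int) \<Rightarrow> real" where
  "continued_radical a = lim (nested_radical a)"

definition sign_seqs :: "nat \<Rightarrow> (nat \<Rightarrow> int) set" where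
  "sign_seqs n = {..<n} \<rightarrow>\<^sub>E {-1, 1}"

definition periodic_ext :: "nat \<Rightarrow> (nat \<Rightarrow> int) \<Rightarrow> nat \<Rightarrow> int" where
  "periodic_ext n a k = a (k mod n)"

lemma periodic_ext_less: "k < n \<Longrightarrow> periodic_ext n a k = a k"
  by (simp add: periodic_ext_def)

lemma periodic_ext_add: "periodic_ext n a (n + k) = periodic_ext n a k"
  by (simp add: periodic_ext_def)

definition sign_prod :: "(nat \<Rightarrow> int) \<Rightarrow> nat \<Rightarrow> int" where
  "sign_prod a m = (\<Prod>k=0..m. a k)"

text \<open>
  For \<open>n = 1\<close> the index set \<open>{..<n - 1}\<close> is empty; otherwise it is \<open>{0..n - 2}\<close>, and
  no subtraction in the exponent truncates.
\<close>

definition twice_ell :: "nat \<Rightarrow> (nat \<Rightarrow> int) \<Rightarrow> int" where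
  "twice_ell n a =
     2 ^ (n - 1) - sign_prod a (n - 1) - (\<Sum>m<n - 1. 2 ^ (n - 2 - m) * sign_prod a m)"

definition ell :: "nat \<Rightarrow> (nat \<Rightarrow> int) \<Rightarrow> int" where
  "ell n a = (THE l. 2 * l = twice_ell n a)"

end

(*
  Writing a value in [-2, 2] as 2 sin y with y in [-pi/2, pi/2], the map x -> a sqrt(2 + x)
  becomes y -> a (pi/4 + y/2).  Hence x_m = 2 sin (pi/2 * S_m) with S_m = sum_{k<m} P_k / 2^(k+1),
  which converges.  If a has period n, then P_(n+k) = P P_k, so the limit S of S_m satisfies
  (2^n - P) S = T with T = sum_{k<n} 2^(n-1-k) P_k, and 4 ell = 2^n - P - T.
  As a binary expansion with digits -1 and 1, T determines its digits, hence a; thus ell is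
  injective on each of the two classes P = 1 and P = -1.  It maps each class into an interval of
  2^(n-1) integers, and the two classes together have 2^n elements, so both maps are onto.
*)
theory Submission imports Defs begin

section \<open>Binary expansions with digits -1 and 1\<close>

text \<open>The leading digit is \<open>p 0\<close>, so appending a digit is a Horner step. For
  \<open>p = sign_prod a\<close> this is the T of the overview.\<close>

definition binary_value :: "(nat \<Rightarrow> int) \<Rightarrow> nat \<Rightarrow> int" where
  "binary_value p n = (\<Sum>k<n. 2 ^ (n - Suc k) * p k)"

lemma binary_value_0 [simp]: "binary_value p 0 = 0"
  by (simp add: binary_value_def)

lemma binary_value_Suc: "binary_value p (Suc n) = 2 * binary_value p n + p n"
proof -
  have "(\<Sum>k<n. 2 ^ (Suc n - Suc k) * p k) = (\<Sum>k<n. 2 * (2 ^ (n - Suc k) * p k))"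
    by (rule sum.cong) (auto simp: Suc_diff_Suc simp flip: power_Suc)
  then show ?thesis
    by (simp add: binary_value_def sum_distrib_left)
qed

lemma abs_binary_value_le:
  assumes "\<And>k. k < n \<Longrightarrow> p k \<in> {-1, 1}"
  shows "\<bar>binary_value p n\<bar> \<le> 2 ^ n - 1"
  using assms
proof (induction n)
  case (Suc n)
  have "\<bar>binary_value p n\<bar> \<le> 2 ^ n - 1" "p n \<in> {-1, 1}"
    using Suc by auto
  then show ?case
    by (auto simp: binary_value_Suc)
qed simp

lemma odd_binary_value:
  assumes "p (n - 1) \<in> {-1, 1}" "n \<ge> 1"
  shows "odd (binary_value p n)"
proof -
  obtain m where "n = Suc m"
    using assms(2) by (cases n) auto
  then show ?thesis
    using assms(1) by (auto simp: binary_value_Suc)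
qed

text \<open>The last digit can be read off modulo 4, because the values of the two prefixes have the
  same parity; induction then recovers the others.\<close>

lemma binary_value_inject:
  assumes "\<And>k. k < n \<Longrightarrow> p k \<in> {-1, 1}" "\<And>k. k < n \<Longrightarrow> q k \<in> {-1, 1}"
    and "binary_value p n = binary_value q n" "k < n"
  shows "p k = q k"
  using assms
proof (induction n arbitrary: k)
  case (Suc n)
  have pq: "p n \<in> {-1, 1}" "q n \<in> {-1, 1}"
    using Suc.prems by auto
  have "even (binary_value p n - binary_value q n)"
  \<comment> \<open>Nonempty prefixes both have odd values, and empty ones both have value
    0.\<close>
  proof (cases n)
    case (Suc m)
    then show ?thesis
      using Suc.prems(1,2) by (simp add: odd_binary_value)
  qed simp
  then obtain c where c: "binary_value p n - binary_value q n = 2 * c"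
    by blast
  have "4 * c = q n - p n"
    using Suc.prems(3) c by (simp add: binary_value_Suc)
  \<comment> \<open>\<open>q n - p n\<close> is -2, 0 or 2, and only 0 is a multiple of 4.\<close>
  with pq have "c = 0"
    by auto
  with c pq Suc.prems(3) have "binary_value p n = binary_value q n" "p n = q n"
    by (auto simp: binary_value_Suc)
  then show ?case
    using Suc.IH Suc.prems(1,2,4) by (metis less_Suc_eq)
qed simp

section \<open>Partial products of signs\<close>

lemma sign_prod_0 [simp]: "sign_prod a 0 = a 0"
  by (simp add: sign_prod_def)

lemma sign_prod_Suc: "sign_prod a (Suc m) = sign_prod a m * a (Suc m)"
  by (simp add: sign_prod_def)

text \<open>Peels off the outermost sign, to match the recursion of \<open>nested_radical\<close> on
  the shifted sequence.\<close>

lemma sign_prod_Suc_shift: "sign_prod a (Suc m) = a 0 * sign_prod (\<lambda>k. a (Suc k)) m"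
  by (induction m) (simp_all add: sign_prod_Suc)

lemma sign_prod_in:
  assumes "\<And>k. k \<le> m \<Longrightarrow> a k \<in> {-1, 1}"
  shows "sign_prod a m \<in> {-1, 1}"
  using assms
proof (induction m)
  case (Suc m)
  have "sign_prod a m \<in> {-1, 1}" "a (Suc m) \<in> {-1, 1}"
    using Suc by auto
  then show ?case
    by (auto simp: sign_prod_Suc)
qed simp

lemma sign_prod_inject:
  assumes "\<And>k. k < n \<Longrightarrow> a k \<in> {-1, 1}"
    and "\<And>k. k < n \<Longrightarrow> sign_prod a k = sign_prod b k" "k < n"
  shows "a k = b k"
proof (cases k)
  case 0
  then show ?thesis
    using assms(2)[of 0] assms(3) by simp
next
  case (Suc m)
  have "sign_prod a m * a (Suc m) = sign_prod a m * b (Suc m)"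
    using assms(2)[of m] assms(2)[of "Suc m"] assms(3) Suc by (simp add: sign_prod_Suc)
  moreover have "sign_prod a m \<in> {-1, 1}"
    using assms(1,3) Suc by (intro sign_prod_in) auto
  ultimately show ?thesis
    using Suc by auto
qed

lemma sign_seqsD: "a \<in> sign_seqs n \<Longrightarrow> k < n \<Longrightarrow> a k \<in> {-1, 1}"
  using PiE_mem[of a "{..<n}" "\<lambda>_. {-1, 1}" k] by (simp add: sign_seqs_def)

lemma sign_prod_sign_seqs:
  assumes "a \<in> sign_seqs n" "k < n"
  shows "sign_prod a k \<in> {-1, 1}"
proof (rule sign_prod_in)
  show "a j \<in> {-1, 1}" if "j \<le> k" for j
    using sign_seqsD[OF assms(1), of j] assms(2) that by simp
qed

section \<open>Integrality of \<open>ell\<close>\<close>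

text \<open>Doubling raises each weight to the one in T; of the two copies of P that arise, one
  becomes the last digit of T.\<close>

lemma two_twice_ell:
  assumes "n \<ge> 1"
  shows "2 * twice_ell n a = 2 ^ n - sign_prod a (n - 1) - binary_value (sign_prod a) n"
proof -
  obtain m where m: "n = Suc m"
    using assms by (cases n) auto
  then show ?thesis
    by (simp add: twice_ell_def binary_value_Suc)
       (simp add: binary_value_def)
qed

lemma even_twice_ell:
  assumes "n \<ge> 1" "a \<in> sign_seqs n"
  shows "even (twice_ell n a)"
proof -
  obtain m where m: "n = Suc m"
    using assms by (cases n) auto
  have e: "twice_ell n a = 2 ^ m - sign_prod a m - binary_value (sign_prod a) m"
    by (simp add: twice_ell_def m) (simp add: binary_value_def)
  have P: "sign_prod a m \<in> {-1, 1}"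
    using assms(2) m by (intro sign_prod_sign_seqs) auto
  \<comment> \<open>For \<open>m = 0\<close> the power is 1 and the expansion is empty, leaving 1
    minus a sign; for \<open>m > 0\<close> the power is even and both subtracted terms are
    odd.\<close>
  show ?thesis
  proof (cases m)
    case 0
    then show ?thesis using P e by auto
  next
    case (Suc l)
    have "odd (binary_value (sign_prod a) m)"
      using assms(2) m Suc by (intro odd_binary_value sign_prod_sign_seqs) auto
    then show ?thesis
      using P e Suc by auto
  qed
qed

lemma two_ell:
  assumes "even (twice_ell n a)"
  shows "2 * ell n a = twice_ell n a"
proof -
  from assms obtain l where "twice_ell n a = 2 * l"
    by blast
  then have "ell n a = l"
    by (simp add: ell_def)
  with \<open>twice_ell n a = 2 * l\<close> show ?thesis
    by simp
qed

lemma four_ell: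
  assumes "n \<ge> 1" "a \<in> sign_seqs n"
  shows "4 * ell n a = 2 ^ n - sign_prod a (n - 1) - binary_value (sign_prod a) n"
  using two_ell[OF even_twice_ell[OF assms]] two_twice_ell[OF assms(1), of a] by linarith

section \<open>Finite radicals as sines\<close>

definition angle_term :: "(nat \<Rightarrow> int) \<Rightarrow> nat \<Rightarrow> real" where
  "angle_term a k = of_int (sign_prod a k) / 2 ^ Suc k"

lemma sum_angle_term: "(\<Sum>k<m. angle_term a k) = of_int (binary_value (sign_prod a) m) / 2 ^ m"
  by (induction m) (simp_all add: angle_term_def binary_value_Suc field_simps)

text \<open>Keeps the angles within [-pi/2, pi/2], where the half-angle formula for the square root
  is valid.\<close>

lemma abs_sum_angle_term_le:
  assumes "\<And>k. a k \<in> {-1, 1}"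
  shows "\<bar>\<Sum>k<m. angle_term a k\<bar> \<le> 1"
proof -
  have "\<bar>binary_value (sign_prod a) m\<bar> \<le> 2 ^ m"
    using abs_binary_value_le[of m "sign_prod a"] sign_prod_in[of _ a] assms by force
  then have "real_of_int \<bar>binary_value (sign_prod a) m\<bar> \<le> real_of_int (2 ^ m)"
    by (simp only: of_int_le_iff)
  then show ?thesis
    by (simp add: sum_angle_term)
qed

text \<open>This is the angle map y -> a (pi/4 + y/2), with angles measured in units of
  pi/2.\<close>

lemma sum_angle_term_Suc_shift:
  "(\<Sum>k<Suc m. angle_term a k) =
     of_int (a 0) * (1/2 + (\<Sum>k<m. angle_term (\<lambda>k. a (Suc k)) k) / 2)"
proof -
  have "(\<Sum>k<Suc m. angle_term a k) = angle_term a 0 + (\<Sum>k<m. angle_term a (Suc k))"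
    by (rule sum.lessThan_Suc_shift)
  also have "(\<Sum>k<m. angle_term a (Suc k)) =
      of_int (a 0) / 2 * (\<Sum>k<m. angle_term (\<lambda>k. a (Suc k)) k)"
    by (simp add: angle_term_def sign_prod_Suc_shift sum_distrib_left)
  also have "angle_term a 0 = of_int (a 0) / 2"
    by (simp add: angle_term_def)
  finally show ?thesis
    by (simp add: distrib_left)
qed

text \<open>Half-angle formula; the bound on \<open>y\<close> puts \<open>pi / 4 + y / 2\<close>
  into [0, pi/2], which makes the sine the nonnegative root.\<close>

lemma sqrt_two_plus_two_sin:
  fixes y :: real
  assumes "\<bar>y\<bar> \<le> pi / 2"
  shows "sqrt (2 + 2 * sin y) = 2 * sin (pi / 4 + y / 2)"
proof -
  have "sin y = - cos (2 * (pi / 4 + y / 2))"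
    by (simp add: cos_add distrib_left)
  also have "\<dots> = 2 * (sin (pi / 4 + y / 2))\<^sup>2 - 1"
    by (simp only: cos_double_sin)
  finally have "2 + 2 * sin y = (2 * sin (pi / 4 + y / 2))\<^sup>2"
    by (simp add: power_mult_distrib)
  moreover have "0 \<le> 2 * sin (pi / 4 + y / 2)"
    using assms by (intro mult_nonneg_nonneg sin_ge_zero) auto
  ultimately show ?thesis
    by (metis real_sqrt_unique)
qed

lemma nested_radical_eq_sin:
  assumes "\<And>k. a k \<in> {-1, 1}"
  shows "nested_radical a m = 2 * sin (pi / 2 * (\<Sum>k<m. angle_term a k))"
  using assms
proof (induction m arbitrary: a)
  case (Suc m)
  let ?b = "\<lambda>k. a (Suc k)"
  let ?S = "\<Sum>k<m. angle_term ?b k"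
  have b: "?b k \<in> {-1, 1}" for k
    using Suc.prems by blast
  have "\<bar>pi / 2 * ?S\<bar> \<le> pi / 2"
    using mult_left_mono[OF abs_sum_angle_term_le[of ?b m, OF b], of "pi / 2"]
    by (simp add: abs_mult)
  then have "nested_radical a (Suc m) = of_int (a 0) * (2 * sin (pi / 4 + (pi / 2 * ?S) / 2))"
    using Suc.IH[of ?b, OF b] by (simp add: sqrt_two_plus_two_sin)
  \<comment> \<open>Since sine is odd, the outer sign moves into the argument.\<close>
  also have "\<dots> = 2 * sin (of_int (a 0) * (pi / 4 + (pi / 2 * ?S) / 2))"
    using Suc.prems[of 0] by (auto simp flip: sin_minus)
  also have "of_int (a 0) * (pi / 4 + (pi / 2 * ?S) / 2) =
      pi / 2 * (\<Sum>k<Suc m. angle_term a k)"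
    unfolding sum_angle_term_Suc_shift by (simp add: field_simps)
  finally show ?case .
qed simp

section \<open>Convergence and the value in the periodic case\<close>

lemma summable_angle_term:
  assumes "\<And>k. a k \<in> {-1, 1}"
  shows "summable (angle_term a)"
proof (rule summable_comparison_test)
  have "norm (angle_term a k) \<le> (1/2) ^ k" for k
    using sign_prod_in[of k a] assms by (auto simp: angle_term_def field_simps)
  then show "\<exists>N. \<forall>k\<ge>N. norm (angle_term a k) \<le> (1/2) ^ k"
    by blast
qed (simp add: summable_geometric)

lemma nested_radical_tendsto:
  assumes "\<And>k. a k \<in> {-1, 1}"
  shows "nested_radical a \<longlonglongrightarrow> 2 * sin (pi / 2 * suminf (angle_term a))"
proof -
  have "(\<lambda>m. 2 * sin (pi / 2 * (\<Sum>k<m. angle_term a k)))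
      \<longlonglongrightarrow> 2 * sin (pi / 2 * suminf (angle_term a))"
    using summable_LIMSEQ[OF summable_angle_term[OF assms]] by (intro tendsto_intros)
  then show ?thesis
    using nested_radical_eq_sin[OF assms] by presburger
qed

text \<open>One full period contributes the factor P, after which the signs repeat.\<close>

lemma sign_prod_period:
  assumes "n \<ge> 1" "\<And>k. a (n + k) = a k"
  shows "sign_prod a (n + k) = sign_prod a (n - 1) * sign_prod a k"
proof (induction k)
  case 0
  then show ?case
    using assms(1) assms(2)[of 0] sign_prod_Suc[of a "n - 1"] by simp
next
  case (Suc k)
  then show ?case
    using assms(2)[of "Suc k"] by (simp add: sign_prod_Suc)
qed

text \<open>The tail after one period is the whole series scaled by P / 2^n, which gives a linear
  equation for the sum.\<close>

lemma suminf_angle_term_period: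
  assumes "n \<ge> 1" "\<And>k. a k \<in> {-1, 1}" "\<And>k. a (n + k) = a k"
  shows "(2 ^ n - of_int (sign_prod a (n - 1))) * suminf (angle_term a) =
    of_int (binary_value (sign_prod a) n)"
proof -
  let ?P = "real_of_int (sign_prod a (n - 1))"
  have shift: "angle_term a (k + n) = ?P / 2 ^ n * angle_term a k" for k
    using sign_prod_period[of n a k, OF assms(1,3)]
    by (simp add: angle_term_def power_add add.commute)
  have "suminf (angle_term a) = (\<Sum>k. angle_term a (k + n)) + (\<Sum>k<n. angle_term a k)"
    using suminf_split_initial_segment[OF summable_angle_term[OF assms(2)]] .
  also have "(\<Sum>k. angle_term a (k + n)) = ?P / 2 ^ n * suminf (angle_term a)"
    unfolding shift by (rule suminf_mult[OF summable_angle_term[OF assms(2)]])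
  finally show ?thesis
    by (simp add: sum_angle_term field_simps)
qed

lemma sign_prod_periodic_ext:
  assumes "m < n"
  shows "sign_prod (periodic_ext n a) m = sign_prod a m"
  unfolding sign_prod_def using assms by (intro prod.cong) (auto simp: periodic_ext_less)

lemma binary_value_periodic_ext:
  "binary_value (sign_prod (periodic_ext n a)) n = binary_value (sign_prod a) n"
  unfolding binary_value_def by (intro sum.cong) (auto simp: sign_prod_periodic_ext)

text \<open>With D = 2^n - P, the relations S = T / D and 4 ell = D - T turn the angle pi/2 * S into
  pi/2 - 2 pi ell / D, so the sine becomes a cosine.\<close>

lemma periodic_radical_tendsto:
  assumes "n \<ge> 1" "a \<in> sign_seqs n"
  shows "nested_radical (periodic_ext n a) \<longlonglongrightarrow>
    2 * cos (2 * pi * of_int (ell n a) / (2 ^ n - of_int (sign_prod a (n - 1))))"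
proof -
  let ?b = "periodic_ext n a"
  let ?D = "2 ^ n - real_of_int (sign_prod a (n - 1))"
  let ?T = "real_of_int (binary_value (sign_prod a) n)"
  have signs: "?b k \<in> {-1, 1}" for k
    using sign_seqsD[OF assms(2), of "k mod n"] assms(1) by (simp add: periodic_ext_def)
  have "(1::real) < 2 ^ n"
    using assms(1) by (intro one_less_power) auto
  moreover have "sign_prod a (n - 1) \<in> {-1, 1}"
    using assms by (intro sign_prod_sign_seqs) auto
  ultimately have D: "?D > 0"
    by fastforce
  have S: "suminf (angle_term ?b) = ?T / ?D"
    using suminf_angle_term_period[of n ?b, OF assms(1) signs periodic_ext_add] D assms(1)
    by (simp add: sign_prod_periodic_ext binary_value_periodic_ext field_simps)
  have "4 * real_of_int (ell n a) = ?D - ?T"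
    using arg_cong[OF four_ell[OF assms], of real_of_int] by simp
  then have "pi / 2 * (?T / ?D) = pi / 2 * ((?D - 4 * of_int (ell n a)) / ?D)"
    by simp
  also have "\<dots> = pi / 2 - 2 * pi * of_int (ell n a) / ?D"
    using D by (simp add: diff_divide_distrib right_diff_distrib)
  finally have "sin (pi / 2 * suminf (angle_term ?b)) = cos (2 * pi * of_int (ell n a) / ?D)"
    by (simp add: S sin_diff)
  then show ?thesis
    using nested_radical_tendsto[of ?b, OF signs] by simp
qed

section \<open>Bijectivity of \<open>ell\<close> on each class\<close>

lemma inj_on_ell:
  assumes "n \<ge> 1"
  shows "inj_on (ell n) {a \<in> sign_seqs n. sign_prod a (n - 1) = P}"
proof (rule inj_onI)
  fix a b
  assume a: "a \<in> {a \<in> sign_seqs n. sign_prod a (n - 1) = P}"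
    and b: "b \<in> {a \<in> sign_seqs n. sign_prod a (n - 1) = P}"
    and eq: "ell n a = ell n b"
  have "binary_value (sign_prod a) n = binary_value (sign_prod b) n"
    using a b eq four_ell[OF assms, of a] four_ell[OF assms, of b] by simp
  moreover have "sign_prod a k \<in> {-1, 1}" "sign_prod b k \<in> {-1, 1}" if "k < n" for k
    using a b that sign_prod_sign_seqs[of _ n k] by simp_all
  ultimately have "sign_prod a k = sign_prod b k" if "k < n" for k
    using binary_value_inject[of n "sign_prod a" "sign_prod b" k] that by blast
  then have "a k = b k" if "k < n" for k
    using sign_prod_inject[of n a b k] a that sign_seqsD[of a n] by blast
  \<comment> \<open>Members of \<open>sign_seqs n\<close> are extensional, so agreement below
    \<open>n\<close> suffices.\<close>
  then show "a = b"
    using a b unfolding sign_seqs_def by (intro PiE_ext[of _ "{..<n}"]) auto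
qed

lemma ell_bounds:
  assumes "n \<ge> 1" "a \<in> sign_seqs n"
  shows "1 - sign_prod a (n - 1) \<le> 4 * ell n a"
    and "4 * ell n a \<le> 2 ^ (n + 1) - 1 - sign_prod a (n - 1)"
proof -
  have "\<bar>binary_value (sign_prod a) n\<bar> \<le> 2 ^ n - 1"
    by (rule abs_binary_value_le) (rule sign_prod_sign_seqs[OF assms(2)])
  then show "1 - sign_prod a (n - 1) \<le> 4 * ell n a"
    "4 * ell n a \<le> 2 ^ (n + 1) - 1 - sign_prod a (n - 1)"
    using four_ell[OF assms] by simp_all
qed

lemma ell_bij_betw:
  assumes "n \<ge> 1"
  shows "bij_betw (ell n) {a \<in> sign_seqs n. sign_prod a (n - 1) = 1} {0..2 ^ (n - 1) - 1}"
    and "bij_betw (ell n) {a \<in> sign_seqs n. sign_prod a (n - 1) = -1} {1..2 ^ (n - 1)}"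
proof -
  let ?A = "\<lambda>P. {a \<in> sign_seqs n. sign_prod a (n - 1) = P}"
  have pow: "(2::int) ^ (n + 1) = 4 * 2 ^ (n - 1)" "(2::nat) ^ n = 2 * 2 ^ (n - 1)"
    using assms by (cases n; simp)+
  \<comment> \<open>The bounds on 4 ell are 0 and 2^(n+1) - 2 for P = 1, and 2 and 2^(n+1) for P =
    -1; integrality rounds them to the stated endpoints.\<close>
  have sub: "ell n ` ?A 1 \<subseteq> {0..2 ^ (n - 1) - 1}" "ell n ` ?A (-1) \<subseteq> {1..2 ^ (n - 1)}"
    using ell_bounds[OF assms] pow(1) by fastforce+
  have fin: "finite (sign_seqs n)"
    unfolding sign_seqs_def by (intro finite_PiE) auto
  have "?A 1 \<union> ?A (-1) = sign_seqs n"
    using sign_prod_sign_seqs[of _ n "n - 1"] assms by auto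
  moreover have "card (sign_seqs n) = 2 ^ n"
    by (simp add: sign_seqs_def card_PiE numeral_2_eq_2)
  ultimately have "card (?A 1) + card (?A (-1)) = 2 ^ n"
    using card_Un_disjoint[of "?A 1" "?A (-1)"] fin by fastforce
  moreover have "card (?A 1) \<le> 2 ^ (n - 1)" "card (?A (-1)) \<le> 2 ^ (n - 1)"
    using card_inj_on_le[OF inj_on_ell[OF assms] sub(1)]
      card_inj_on_le[OF inj_on_ell[OF assms] sub(2)]
    by (simp_all add: nat_power_eq)
  \<comment> \<open>The two upper bounds add up to exactly 2^n, so neither is strict.\<close>
  ultimately have "card (?A 1) = 2 ^ (n - 1)" "card (?A (-1)) = 2 ^ (n - 1)"
    using pow(2) by auto
  then have "card (ell n ` ?A 1) = 2 ^ (n - 1)" "card (ell n ` ?A (-1)) = 2 ^ (n - 1)"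
    using card_image[OF inj_on_ell[OF assms]] by metis+
  then have "ell n ` ?A 1 = {0..2 ^ (n - 1) - 1}" "ell n ` ?A (-1) = {1..2 ^ (n - 1)}"
    using card_subset_eq[OF _ sub(1)] card_subset_eq[OF _ sub(2)] by (simp_all add: nat_power_eq)
  then show "bij_betw (ell n) (?A 1) {0..2 ^ (n - 1) - 1}"
    "bij_betw (ell n) (?A (-1)) {1..2 ^ (n - 1)}"
    using inj_on_ell[OF assms] by (simp_all add: bij_betw_def)
qed

theorem mainTheorem1:
  fixes n :: nat
  assumes "n \<ge> 1"
  shows
    "(\<forall>a \<in> sign_seqs n.
        (\<exists>!l::int. 2 * l = twice_ell n a) \<and>
        continued_radical_converges (periodic_ext n a) \<and>
        continued_radical (periodic_ext n a) =
          2 * cos (2 * pi * real_of_int (ell n a) /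
                   (2 ^ n - real_of_int (sign_prod a (n - 1))))) \<and>
     bij_betw (ell n) {a \<in> sign_seqs n. sign_prod a (n - 1) = 1} {0..2 ^ (n - 1) - 1} \<and>
     (\<lambda>a. continued_radical (periodic_ext n a)) ` {a \<in> sign_seqs n. sign_prod a (n - 1) = 1} =
       (\<lambda>l. 2 * cos (2 * pi * real_of_int l / (2 ^ n - 1))) ` {0..2 ^ (n - 1) - 1} \<and>
     bij_betw (ell n) {a \<in> sign_seqs n. sign_prod a (n - 1) = -1} {1..2 ^ (n - 1)} \<and>
     (\<lambda>a. continued_radical (periodic_ext n a)) ` {a \<in> sign_seqs n. sign_prod a (n - 1) = -1} =
       (\<lambda>l. 2 * cos (2 * pi * real_of_int l / (2 ^ n + 1))) ` {1..2 ^ (n - 1)}"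
proof -
  let ?A = "\<lambda>P. {a \<in> sign_seqs n. sign_prod a (n - 1) = P}"
  have uniq: "\<exists>!l::int. 2 * l = twice_ell n a" if "a \<in> sign_seqs n" for a
  proof (rule ex1I)
    show ell: "2 * ell n a = twice_ell n a"
      using even_twice_ell[OF assms that] by (rule two_ell)
    show "l = ell n a" if "2 * l = twice_ell n a" for l
      using that ell by linarith
  qed
  have conv: "continued_radical_converges (periodic_ext n a)" if "a \<in> sign_seqs n" for a
    using periodic_radical_tendsto[OF assms that]
    unfolding continued_radical_converges_def by (rule convergentI)
  have val: "continued_radical (periodic_ext n a) =
      2 * cos (2 * pi * of_int (ell n a) / (2 ^ n - of_int (sign_prod a (n - 1))))"
    if "a \<in> sign_seqs n" for a
    unfolding continued_radical_def by (rule limI[OF periodic_radical_tendsto[OF assms that]])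
  \<comment> \<open>For fixed P the value depends on \<open>a\<close> only through
    \<open>ell n a\<close>, so surjectivity of \<open>ell n\<close> onto the interval yields the set
    of values.\<close>
  have "(\<lambda>a. continued_radical (periodic_ext n a)) ` ?A P =
      (\<lambda>l. 2 * cos (2 * pi * of_int l / (2 ^ n - of_int P))) ` ell n ` ?A P" for P
    unfolding image_image by (rule image_cong) (auto simp: val)
  from this[of 1] this[of "-1"] show ?thesis
    using uniq conv val ell_bij_betw[OF assms] by (simp add: bij_betw_imp_surj_on)
qed

end
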